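(* Let $f:2^{\Omega}\to\mathbb{R}$ be a set cover function on a finite set $\Omega$, and let $A,B\subseteq\Omega$ be disjoint. With the independence relations between $A$ and $B$ with respect to $f$ defined in the context, $$ModI \implies JI \iff MI \iff SMI \iff PI .$$ However, $JI$ does not imply $ModI$ in general: there exist a finite set $\Omega$, a set cover function $f$ on $\Omega$, and disjoint $A,B\subseteq\Omega$ for which $JI$ holds and $ModI$ fails.
   Context: A set cover function on a finite set $\Omega$ is a function of the form $f(A)=w(\gamma(A))$, where $U$ is a finite set of concepts, each $a\in\Omega$ is assigned a subset $\gamma(a)\subseteq U$ of concepts it covers, $\gamma(A)=\bigcup_{a\in A}\gamma(a)$, and $w(C)=\sum_{u\in C}w_u$ for $C\subseteq U$ with non-negative weights $w_u\ge 0$ (for unit weights, $f(A)=|\gamma(A)|$). For $S,T\subseteq\Omega$ write $f(S|T)=f(S\cup T)-f(T)$, and $I_f(S;T)=f(S)+f(T)-f(S\cup T)$. For disjoint $A,B\subseteq\Omega$, the independence relations with respect to $f$ are: $JI$ (joint independence): $I_f(A;B)=0$, equivalently $f(A|B)=f(A)$. $MI$ (marginal independence): $f(\{a\}|B)=f(\{a\})$ for all $a\in A$, and $f(\{b\}|A)=f(\{b\})$ for all $b\in B$. $PI$ (pairwise independence): $f(\{a\}|\{b\})=f(\{a\})$ and $f(\{b\}|\{a\})=f(\{b\})$ for all $a\in A$, $b\in B$. $SMI$ (subset marginal independence): $f(\{a\}|X)=f(\{a\})$ for all $a\in A$, $X\subseteq B$, and $f(\{b\}|X)=f(\{b\})$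 for all $b\in B$, $X\subseteq A$. $ModI$ (modular independence): $f(\{j\}|X)=f(\{j\})$ for all $X\subseteq A\cup B$ and all $j\in (A\cup B)\setminus X$. *)

theory Defs
  imports Complex_Main
begin

definition covered :: "('a \<Rightarrow> 'c set) \<Rightarrow> 'a set \<Rightarrow> 'c set" where
  "covered \<gamma> A = (\<Union>a\<in>A. \<gamma> a)"

(* The concept set U, the cover map and the weights are explicit parameters, so the type of
   concepts stays arbitrary. Only the values of f on subsets of \<Omega> are constrained. *)
definition set_cover_function ::
  "'a set \<Rightarrow> 'c set \<Rightarrow> ('a \<Rightarrow> 'c set) \<Rightarrow> ('c \<Rightarrow> real) \<Rightarrow> ('a set \<Rightarrow> real) \<Rightarrow> bool" where
  "set_cover_function \<Omega> U \<gamma> w f \<longleftrightarrow>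
     finite \<Omega> \<and> finite U \<and> (\<forall>a\<in>\<Omega>. \<gamma> a \<subseteq> U) \<and> (\<forall>u\<in>U. 0 \<le> w u) \<and>
     (\<forall>A\<subseteq>\<Omega>. f A = (\<Sum>u\<in>covered \<gamma> A. w u))"

(* f(S|T) *)
definition gain :: "('a set \<Rightarrow> real) \<Rightarrow> 'a set \<Rightarrow> 'a set \<Rightarrow> real" where
  "gain f S T = f (S \<union> T) - f T"

(* I_f(S;T) *)
definition mutual_info :: "('a set \<Rightarrow> real) \<Rightarrow> 'a set \<Rightarrow> 'a set \<Rightarrow> real" where
  "mutual_info f S T = f S + f T - f (S \<union> T)"

definition JI :: "('a set \<Rightarrow> real) \<Rightarrow> 'a set \<Rightarrow> 'a set \<Rightarrow> bool" where
  "JI f A B \<longleftrightarrow> mutual_info f A B = 0"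

definition MI :: "('a set \<Rightarrow> real) \<Rightarrow> 'a set \<Rightarrow> 'a set \<Rightarrow> bool" where
  "MI f A B \<longleftrightarrow>
     (\<forall>a\<in>A. gain f {a} B = f {a}) \<and> (\<forall>b\<in>B. gain f {b} A = f {b})"

definition PI :: "('a set \<Rightarrow> real) \<Rightarrow> 'a set \<Rightarrow> 'a set \<Rightarrow> bool" where
  "PI f A B \<longleftrightarrow>
     (\<forall>a\<in>A. \<forall>b\<in>B. gain f {a} {b} = f {a} \<and> gain f {b} {a} = f {b})"

definition SMI :: "('a set \<Rightarrow> real) \<Rightarrow> 'a set \<Rightarrow> 'a set \<Rightarrow> bool" where
  "SMI f A B \<longleftrightarrow>
     (\<forall>a\<in>A. \<forall>X\<subseteq>B. gain f {a} X = f {a}) \<and>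
     (\<forall>b\<in>B. \<forall>X\<subseteq>A. gain f {b} X = f {b})"

definition ModI :: "('a set \<Rightarrow> real) \<Rightarrow> 'a set \<Rightarrow> 'a set \<Rightarrow> bool" where
  "ModI f A B \<longleftrightarrow>
     (\<forall>X\<subseteq>A \<union> B. \<forall>j\<in>(A \<union> B) - X. gain f {j} X = f {j})"

end

(* I_f(S;T) is the total weight of the concepts covered by both S and T. As weights are
   non-negative, it vanishes iff no concept of positive weight is shared by some s in S and some
   t in T, a condition on pairs. JI, MI, SMI and PI all reduce to this condition for (A, B). ModI
   also separates elements within A, so JI holds and ModI fails when two elements of A cover the
   same concept and B covers another one. *)
theory Submission
  imports Defs
begin

lemma covered_singleton [simp]: "covered \<gamma> {a} = \<gamma> a"
  by (simp add: covered_def)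

lemma covered_Un: "covered \<gamma> (S \<union> T) = covered \<gamma> S \<union> covered \<gamma> T"
  by (auto simp: covered_def)

text \<open>Pure rearrangement, valid for every \<open>f\<close>. It turns each clause of
  \<open>MI\<close>, \<open>SMI\<close>, \<open>PI\<close> and \<open>ModI\<close> into the
  vanishing of a mutual information, so that one criterion serves all of them.\<close>

lemma gain_eq_iff_mutual_info: "gain f S T = f S \<longleftrightarrow> mutual_info f S T = 0"
  by (auto simp: gain_def mutual_info_def)

text \<open>Inclusion-exclusion for weighted sums: \<open>covered\<close> sends unions to unions,
  and \<open>w\<close> sums additively over finite sets up to the overlap.\<close>

lemma mutual_info_set_cover:
  assumes f: "set_cover_function \<Omega> U \<gamma> w f" and S: "S \<subseteq> \<Omega>" and T: "T \<subseteq> \<Omega>"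
  shows "mutual_info f S T = (\<Sum>u\<in>covered \<gamma> S \<inter> covered \<gamma> T. w u)"
proof -
  have fin: "finite (covered \<gamma> X)" if "X \<subseteq> \<Omega>" for X
    using f that unfolding set_cover_function_def covered_def
    by (meson UN_least finite_subset subset_iff)
  have val: "f X = (\<Sum>u\<in>covered \<gamma> X. w u)" if "X \<subseteq> \<Omega>" for X
    using f that unfolding set_cover_function_def by blast
  have "f (S \<union> T) = (\<Sum>u\<in>covered \<gamma> S \<union> covered \<gamma> T. w u)"
    using val[of "S \<union> T"] S T by (simp add: covered_Un)
  then show ?thesis
    using val[OF S] val[OF T] sum.union_inter[OF fin[OF S] fin[OF T], of w]
    by (simp add: mutual_info_def)
qed

lemma mutual_info_eq_0_iff_pairwise:
  assumes f: "set_cover_function \<Omega> U \<gamma> w f" and S: "S \<subseteq> \<Omega>" and T: "T \<subseteq> \<Omega>"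
  shows "mutual_info f S T = 0 \<longleftrightarrow> (\<forall>s\<in>S. \<forall>t\<in>T. \<forall>u\<in>\<gamma> s \<inter> \<gamma> t. w u = 0)"
proof -
  let ?C = "covered \<gamma> S \<inter> covered \<gamma> T"
  \<comment> \<open>Lying in \<open>U\<close> gives the shared concepts both finiteness and
    non-negative weights, so their sum is zero only if every term is.\<close>
  have sub: "?C \<subseteq> U"
    using f S unfolding set_cover_function_def covered_def by blast
  then have "finite ?C" and "\<And>u. u \<in> ?C \<Longrightarrow> 0 \<le> w u"
    using f unfolding set_cover_function_def by (auto intro: finite_subset)
  then have "mutual_info f S T = 0 \<longleftrightarrow> (\<forall>u\<in>?C. w u = 0)"
    unfolding mutual_info_set_cover[OF assms] by (rule sum_nonneg_eq_0_iff)
  then show ?thesis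
    by (auto simp: covered_def)
qed

text \<open>Each relation is shown equivalent to the same pairwise condition \<open>?P\<close>; the
  stated equivalences then follow by chaining.\<close>

lemma independence_equivalences:
  assumes f: "set_cover_function \<Omega> U \<gamma> w f" and A: "A \<subseteq> \<Omega>" and B: "B \<subseteq> \<Omega>"
  shows "JI f A B \<longleftrightarrow> MI f A B" "MI f A B \<longleftrightarrow> SMI f A B" "SMI f A B \<longleftrightarrow> PI f A B"
proof -
  let ?P = "\<forall>a\<in>A. \<forall>b\<in>B. \<forall>u\<in>\<gamma> a \<inter> \<gamma> b. w u = 0"
  \<comment> \<open>The criterion with a singleton on the left is a conjunction over the elements of
    \<open>X\<close>, so it passes to subsets of \<open>X\<close> and is determined by
    singletons.\<close>
  have gain_iff: "gain f {x} X = f {x} \<longleftrightarrow> (\<forall>y\<in>X. \<forall>u\<in>\<gamma> x \<inter> \<gamma> y. w u = 0)"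
    if "x \<in> \<Omega>" "X \<subseteq> \<Omega>" for x X
    using mutual_info_eq_0_iff_pairwise[OF f, of "{x}" X] that
    by (simp add: gain_eq_iff_mutual_info)
  have "JI f A B \<longleftrightarrow> ?P"
    unfolding JI_def by (rule mutual_info_eq_0_iff_pairwise[OF assms])
  moreover have "MI f A B \<longleftrightarrow> ?P"
  proof -
    have "gain f {a} B = f {a} \<longleftrightarrow> (\<forall>b\<in>B. \<forall>u\<in>\<gamma> a \<inter> \<gamma> b. w u = 0)" if "a \<in> A" for a
      using gain_iff[of a B] A B that by blast
    moreover have "gain f {b} A = f {b} \<longleftrightarrow> (\<forall>a\<in>A. \<forall>u\<in>\<gamma> b \<inter> \<gamma> a. w u = 0)" if "b \<in> B" for b
      using gain_iff[of b A] A B that by blast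
    ultimately show ?thesis
      \<comment> \<open>Both halves of \<open>MI\<close> express \<open>?P\<close>, the second with
        the two quantifiers exchanged.\<close>
      unfolding MI_def by (simp add: Int_commute) blast
  qed
  moreover have "SMI f A B \<longleftrightarrow> ?P"
  proof
    assume "SMI f A B"
    \<comment> \<open>Instantiate \<open>X\<close> with all of \<open>B\<close>, respectively all of
      \<open>A\<close>.\<close>
    then have "MI f A B"
      unfolding SMI_def MI_def by blast
    then show ?P
      using \<open>MI f A B \<longleftrightarrow> ?P\<close> by blast
  next
    assume P: ?P
    have "gain f {a} X = f {a}" if "a \<in> A" "X \<subseteq> B" for a X
      using gain_iff[of a X] A B P that by blast
    moreover have "gain f {b} X = f {b}" if "b \<in> B" "X \<subseteq> A" for b X
      using gain_iff[of b X] A B P that by blast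
    ultimately show "SMI f A B"
      unfolding SMI_def by blast
  qed
  moreover have "PI f A B \<longleftrightarrow> ?P"
  proof -
    have "gain f {a} {b} = f {a} \<longleftrightarrow> (\<forall>u\<in>\<gamma> a \<inter> \<gamma> b. w u = 0)"
      "gain f {b} {a} = f {b} \<longleftrightarrow> (\<forall>u\<in>\<gamma> a \<inter> \<gamma> b. w u = 0)" if "a \<in> A" "b \<in> B" for a b
      using gain_iff[of a "{b}"] gain_iff[of b "{a}"] A B that by auto
    then show ?thesis
      unfolding PI_def by simp
  qed
  ultimately show "JI f A B \<longleftrightarrow> MI f A B" "MI f A B \<longleftrightarrow> SMI f A B" "SMI f A B \<longleftrightarrow> PI f A B"
    by blast+
qed

text \<open>Disjointness keeps each \<open>a\<close> in \<open>A\<close> outside \<open>B\<close>,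
  so \<open>X = B\<close> and \<open>j = a\<close> is an admissible instance of \<open>ModI\<close>;
  likewise with the roles exchanged.\<close>

lemma ModI_imp_MI:
  assumes "ModI f A B" "A \<inter> B = {}"
  shows "MI f A B"
  using assms unfolding ModI_def MI_def by blast

lemma JI_not_imp_ModI:
  "\<exists>(\<Omega> :: nat set) (U :: nat set) \<gamma> w f A B.
     set_cover_function \<Omega> U \<gamma> w f \<and> A \<subseteq> \<Omega> \<and> B \<subseteq> \<Omega> \<and> A \<inter> B = {} \<and> JI f A B \<and> \<not> ModI f A B"
proof -
  \<comment> \<open>Elements 0 and 1 both cover concept 0, while 2 alone covers concept 1. With unit
    weights, \<open>{0, 1}\<close> and \<open>{2}\<close> share nothing.\<close>
  define \<gamma> :: "nat \<Rightarrow> nat set" where "\<gamma> = (\<lambda>a. if a = 2 then {1} else {0})"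
  define f :: "nat set \<Rightarrow> real" where "f = (\<lambda>S. \<Sum>u\<in>covered \<gamma> S. 1)"
  have f: "set_cover_function {0, 1, 2} {0, 1} \<gamma> (\<lambda>_. 1) f"
    by (auto simp: set_cover_function_def f_def \<gamma>_def)
  have "JI f {0, 1} {2}"
    unfolding JI_def by (subst mutual_info_eq_0_iff_pairwise[OF f]) (auto simp: \<gamma>_def)
  \<comment> \<open>The redundancy inside \<open>A\<close> breaks \<open>ModI\<close> at
    \<open>X = {0}\<close>, \<open>j = 1\<close>: concept 0 is shared and has weight 1.\<close>
  moreover have "gain f {1} {0} \<noteq> f {1}"
    unfolding gain_eq_iff_mutual_info
    by (subst mutual_info_eq_0_iff_pairwise[OF f]) (auto simp: \<gamma>_def)
  then have "\<not> ModI f {0, 1} {2}"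
    unfolding ModI_def by fastforce
  ultimately show ?thesis
    using f by (intro exI[of _ "{0, 1, 2}"] exI[of _ "{0, 1}"] exI[of _ \<gamma>]
        exI[of _ "\<lambda>_. 1"] exI[of _ f] exI[of _ "{0, 1}"] exI[of _ "{2}"] conjI) simp_all
qed

theorem mainTheorem2:
  shows "(\<forall>(\<Omega> :: 'a set) (U :: 'c set) \<gamma> w f A B.
            set_cover_function \<Omega> U \<gamma> w f \<and> A \<subseteq> \<Omega> \<and> B \<subseteq> \<Omega> \<and> A \<inter> B = {} \<longrightarrow>
              (ModI f A B \<longrightarrow> JI f A B) \<and>
              (JI f A B \<longleftrightarrow> MI f A B) \<and>
              (MI f A B \<longleftrightarrow> SMI f A B) \<and>
              (SMI f A B \<longleftrightarrow> PI f A B)) \<and>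
         (\<exists>(\<Omega> :: nat set) (U :: nat set) \<gamma> w f A B.
            set_cover_function \<Omega> U \<gamma> w f \<and> A \<subseteq> \<Omega> \<and> B \<subseteq> \<Omega> \<and> A \<inter> B = {} \<and>
              JI f A B \<and> \<not> ModI f A B)"
proof (intro conjI)
  show "\<forall>(\<Omega> :: 'a set) (U :: 'c set) \<gamma> w f A B.
          set_cover_function \<Omega> U \<gamma> w f \<and> A \<subseteq> \<Omega> \<and> B \<subseteq> \<Omega> \<and> A \<inter> B = {} \<longrightarrow>
            (ModI f A B \<longrightarrow> JI f A B) \<and>
            (JI f A B \<longleftrightarrow> MI f A B) \<and>
            (MI f A B \<longleftrightarrow> SMI f A B) \<and>
            (SMI f A B \<longleftrightarrow> PI f A B)"
  proof (intro allI impI, elim conjE)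
    fix \<Omega> :: "'a set" and U :: "'c set" and \<gamma> w f A B
    assume "set_cover_function \<Omega> U \<gamma> w f" "A \<subseteq> \<Omega>" "B \<subseteq> \<Omega>" and disj: "A \<inter> B = {}"
    note equivs = independence_equivalences[OF this(1-3)]
    have "ModI f A B \<longrightarrow> JI f A B"
      using ModI_imp_MI[OF _ disj] equivs(1) by simp
    with equivs show "(ModI f A B \<longrightarrow> JI f A B) \<and> (JI f A B \<longleftrightarrow> MI f A B) \<and>
        (MI f A B \<longleftrightarrow> SMI f A B) \<and> (SMI f A B \<longleftrightarrow> PI f A B)"
      by (intro conjI)
  qed
qed (rule JI_not_imp_ModI)

end
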